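(* Let $\boldsymbol\psi_1,\boldsymbol\psi_2,\boldsymbol\psi_3,\dots$ be a list of all the sentences of the fixed countable language. For a theory $T$ put $$\mathscr{V}(T)=\sum_{n>0}2^{-n}\,\mathcal{W}^{\{\boldsymbol\psi_n\}}(T),\qquad \mathcal{W}^{\{\boldsymbol\psi_n\}}(T)=\begin{cases}0&\text{if }T\nvdash\boldsymbol\psi_n,\\ 1&\text{if }T\vdash\boldsymbol\psi_n.\end{cases}$$ Then $\mathscr{V}$ satisfies both HP and EP for all theories; that is, for all theories $T$ and $U$: (HP) if $\mathscr{V}(U)>\mathscr{V}(T)$ then $T\nvdash U$; and (EP) if $\mathscr{V}(T)=\mathscr{V}(U)$ then $T\equiv U$.
   Context: Fix a countable language and classical (propositional or first-order) logic over it. A theory is an arbitrary set of sentences. $T\vdash\psi$ means $\psi$ is provable from $T$; for theories $T,U$, $T\vdash U$ means $T$ proves every sentence in $U$, and $T\equiv U$ means $T\vdash U$ and $U\vdash T$. *)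

theory Defs
  imports Complex_Main "HOL-Library.Countable_Set"
begin

datatype 'a pform =
    PAtom 'a
  | PBot
  | PAnd "'a pform" "'a pform"
  | POr "'a pform" "'a pform"
  | PImp "'a pform" "'a pform"

text \<open>Negation is \<open>PImp p PBot\<close>.\<close>

fun patoms :: "'a pform \<Rightarrow> 'a set" where
  "patoms (PAtom a) = {a}"
| "patoms PBot = {}"
| "patoms (PAnd p q) = patoms p \<union> patoms q"
| "patoms (POr p q) = patoms p \<union> patoms q"
| "patoms (PImp p q) = patoms p \<union> patoms q"

definition psentences :: "'a set \<Rightarrow> 'a pform set" where
  "psentences A = {p. patoms p \<subseteq> A}"

inductive paxiom :: "'a pform \<Rightarrow> bool" where
  "paxiom (PImp p (PImp q p))"
| "paxiom (PImp (PImp p (PImp q r)) (PImp (PImp p q) (PImp p r)))"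
| "paxiom (PImp p (PImp q (PAnd p q)))"
| "paxiom (PImp (PAnd p q) p)"
| "paxiom (PImp (PAnd p q) q)"
| "paxiom (PImp p (POr p q))"
| "paxiom (PImp q (POr p q))"
| "paxiom (PImp (PImp p r) (PImp (PImp q r) (PImp (POr p q) r)))"
| "paxiom (PImp (PImp (PImp p PBot) PBot) p)"

inductive pprovable :: "'a set \<Rightarrow> 'a pform set \<Rightarrow> 'a pform \<Rightarrow> bool"
  for A :: "'a set" and T :: "'a pform set" where
  hyp: "p \<in> T \<Longrightarrow> pprovable A T p"
| ax: "paxiom p \<Longrightarrow> p \<in> psentences A \<Longrightarrow> pprovable A T p"
| mp: "pprovable A T (PImp p q) \<Longrightarrow> pprovable A T p \<Longrightarrow> pprovable A T q"

text \<open>The field \<open>has_eq\<close> says whether identity belongs to the logical vocabulary, so that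
  first-order logic with and without identity are both covered.\<close>

record ('f, 'r) lang =
  funs :: "'f set"
  rels :: "'r set"
  farity :: "'f \<Rightarrow> nat"
  rarity :: "'r \<Rightarrow> nat"
  has_eq :: bool

datatype 'f tm = Var nat | Fn 'f "'f tm list"

datatype ('f, 'r) fm =
    Rel 'r "'f tm list"
  | Eq "'f tm" "'f tm"
  | Bot
  | And "('f, 'r) fm" "('f, 'r) fm"
  | Or "('f, 'r) fm" "('f, 'r) fm"
  | Imp "('f, 'r) fm" "('f, 'r) fm"
  | All nat "('f, 'r) fm"
  | Ex nat "('f, 'r) fm"

fun wf_tm :: "('f, 'r) lang \<Rightarrow> 'f tm \<Rightarrow> bool" where
  "wf_tm L (Var x) = True"
| "wf_tm L (Fn f ts) = (f \<in> funs L \<and> length ts = farity L f \<and> (\<forall>t\<in>set ts. wf_tm L t))"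

fun wf_fm :: "('f, 'r) lang \<Rightarrow> ('f, 'r) fm \<Rightarrow> bool" where
  "wf_fm L (Rel r ts) = (r \<in> rels L \<and> length ts = rarity L r \<and> (\<forall>t\<in>set ts. wf_tm L t))"
| "wf_fm L (Eq s t) = (has_eq L \<and> wf_tm L s \<and> wf_tm L t)"
| "wf_fm L Bot = True"
| "wf_fm L (And p q) = (wf_fm L p \<and> wf_fm L q)"
| "wf_fm L (Or p q) = (wf_fm L p \<and> wf_fm L q)"
| "wf_fm L (Imp p q) = (wf_fm L p \<and> wf_fm L q)"
| "wf_fm L (All x p) = wf_fm L p"
| "wf_fm L (Ex x p) = wf_fm L p"

fun vars_tm :: "'f tm \<Rightarrow> nat set" where
  "vars_tm (Var x) = {x}"
| "vars_tm (Fn f ts) = (\<Union>t\<in>set ts. vars_tm t)"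

fun free_vars :: "('f, 'r) fm \<Rightarrow> nat set" where
  "free_vars (Rel r ts) = (\<Union>t\<in>set ts. vars_tm t)"
| "free_vars (Eq s t) = vars_tm s \<union> vars_tm t"
| "free_vars Bot = {}"
| "free_vars (And p q) = free_vars p \<union> free_vars q"
| "free_vars (Or p q) = free_vars p \<union> free_vars q"
| "free_vars (Imp p q) = free_vars p \<union> free_vars q"
| "free_vars (All x p) = free_vars p - {x}"
| "free_vars (Ex x p) = free_vars p - {x}"

definition sentences :: "('f, 'r) lang \<Rightarrow> ('f, 'r) fm set" where
  "sentences L = {p. wf_fm L p \<and> free_vars p = {}}"

fun subst_tm :: "nat \<Rightarrow> 'f tm \<Rightarrow> 'f tm \<Rightarrow> 'f tm" where
  "subst_tm x s (Var y) = (if y = x then s else Var y)"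
| "subst_tm x s (Fn f ts) = Fn f (map (subst_tm x s) ts)"

text \<open>Replacement of the free occurrences of a variable, without renaming of bound variables;
  it is only used under the side condition \<open>free_for\<close>.\<close>

fun subst :: "nat \<Rightarrow> 'f tm \<Rightarrow> ('f, 'r) fm \<Rightarrow> ('f, 'r) fm" where
  "subst x s (Rel r ts) = Rel r (map (subst_tm x s) ts)"
| "subst x s (Eq t u) = Eq (subst_tm x s t) (subst_tm x s u)"
| "subst x s Bot = Bot"
| "subst x s (And p q) = And (subst x s p) (subst x s q)"
| "subst x s (Or p q) = Or (subst x s p) (subst x s q)"
| "subst x s (Imp p q) = Imp (subst x s p) (subst x s q)"
| "subst x s (All y p) = (if y = x then All y p else All y (subst x s p))"
| "subst x s (Ex y p) = (if y = x then Ex y p else Ex y (subst x s p))"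

text \<open>\<open>free_for s x p\<close>: no free occurrence of \<open>x\<close> in \<open>p\<close> lies in the scope of a quantifier
  binding a variable of \<open>s\<close>.\<close>

fun free_for :: "'f tm \<Rightarrow> nat \<Rightarrow> ('f, 'r) fm \<Rightarrow> bool" where
  "free_for s x (Rel r ts) = True"
| "free_for s x (Eq t u) = True"
| "free_for s x Bot = True"
| "free_for s x (And p q) = (free_for s x p \<and> free_for s x q)"
| "free_for s x (Or p q) = (free_for s x p \<and> free_for s x q)"
| "free_for s x (Imp p q) = (free_for s x p \<and> free_for s x q)"
| "free_for s x (All y p) = (x \<notin> free_vars (All y p) \<or> (y \<notin> vars_tm s \<and> free_for s x p))"
| "free_for s x (Ex y p) = (x \<notin> free_vars (Ex y p) \<or> (y \<notin> vars_tm s \<and> free_for s x p))"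

inductive axiom :: "('f, 'r) fm \<Rightarrow> bool" where
  "axiom (Imp p (Imp q p))"
| "axiom (Imp (Imp p (Imp q r)) (Imp (Imp p q) (Imp p r)))"
| "axiom (Imp p (Imp q (And p q)))"
| "axiom (Imp (And p q) p)"
| "axiom (Imp (And p q) q)"
| "axiom (Imp p (Or p q))"
| "axiom (Imp q (Or p q))"
| "axiom (Imp (Imp p r) (Imp (Imp q r) (Imp (Or p q) r)))"
| "axiom (Imp (Imp (Imp p Bot) Bot) p)"
| "free_for t x p \<Longrightarrow> axiom (Imp (All x p) (subst x t p))"
| "x \<notin> free_vars p \<Longrightarrow> axiom (Imp (All x (Imp p q)) (Imp p (All x q)))"
| "free_for t x p \<Longrightarrow> axiom (Imp (subst x t p) (Ex x p))"
| "x \<notin> free_vars q \<Longrightarrow> axiom (Imp (All x (Imp p q)) (Imp (Ex x p) q))"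
| "axiom (Eq t t)"
| "free_for s x p \<Longrightarrow> free_for t x p \<Longrightarrow>
     axiom (Imp (Eq s t) (Imp (subst x s p) (subst x t p)))"

text \<open>Generalization is unrestricted, as is standard in Hilbert calculi whose nonlogical axioms
  \<open>T\<close> are sentences.\<close>

inductive provable :: "('f, 'r) lang \<Rightarrow> ('f, 'r) fm set \<Rightarrow> ('f, 'r) fm \<Rightarrow> bool"
  for L :: "('f, 'r) lang" and T :: "('f, 'r) fm set" where
  hyp: "p \<in> T \<Longrightarrow> provable L T p"
| ax: "axiom p \<Longrightarrow> wf_fm L p \<Longrightarrow> provable L T p"
| mp: "provable L T (Imp p q) \<Longrightarrow> provable L T p \<Longrightarrow> provable L T q"
| gen: "provable L T p \<Longrightarrow> provable L T (All x p)"

text \<open>In the following, \<open>S\<close> is the set of sentences of the logic at hand and \<open>pr T p\<close> is its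
  provability relation; a theory is a subset of \<open>S\<close>.\<close>

definition proves_theory :: "('s set \<Rightarrow> 's \<Rightarrow> bool) \<Rightarrow> 's set \<Rightarrow> 's set \<Rightarrow> bool" where
  "proves_theory pr T U \<longleftrightarrow> (\<forall>p\<in>U. pr T p)"

definition equiv_theory :: "('s set \<Rightarrow> 's \<Rightarrow> bool) \<Rightarrow> 's set \<Rightarrow> 's set \<Rightarrow> bool" where
  "equiv_theory pr T U \<longleftrightarrow> proves_theory pr T U \<and> proves_theory pr U T"

definition W :: "('s set \<Rightarrow> 's \<Rightarrow> bool) \<Rightarrow> 's set \<Rightarrow> 's set \<Rightarrow> real" where
  "W pr V T = (if proves_theory pr T V then 1 else 0)"

text \<open>The list \<open>\<psi>\<close> is indexed from 1; \<open>\<psi> 0\<close> is not used.\<close>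

definition valuation :: "('s set \<Rightarrow> 's \<Rightarrow> bool) \<Rightarrow> (nat \<Rightarrow> 's) \<Rightarrow> 's set \<Rightarrow> real" where
  "valuation pr \<psi> T = (\<Sum>k. (1/2) ^ Suc k * W pr {\<psi> (Suc k)} T)"

definition lists_all :: "(nat \<Rightarrow> 's) \<Rightarrow> 's set \<Rightarrow> bool" where
  "lists_all \<psi> S \<longleftrightarrow> \<psi> ` {0<..} = S"

definition HP :: "'s set \<Rightarrow> ('s set \<Rightarrow> 's \<Rightarrow> bool) \<Rightarrow> ('s set \<Rightarrow> real) \<Rightarrow> bool" where
  "HP S pr v \<longleftrightarrow> (\<forall>T U. T \<subseteq> S \<longrightarrow> U \<subseteq> S \<longrightarrow> v U > v T \<longrightarrow> \<not> proves_theory pr T U)"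

definition EP :: "'s set \<Rightarrow> ('s set \<Rightarrow> 's \<Rightarrow> bool) \<Rightarrow> ('s set \<Rightarrow> real) \<Rightarrow> bool" where
  "EP S pr v \<longleftrightarrow> (\<forall>T U. T \<subseteq> S \<longrightarrow> U \<subseteq> S \<longrightarrow> v T = v U \<longrightarrow> equiv_theory pr T U)"

end

theory Submission
  imports Defs
begin

text \<open>HP is monotonicity of the valuation, which is the cut rule.  For EP, the valuation is a binary
  expansion with digit 1 at the indices of theorems.  Binary expansions are ambiguous only between
  a tail of ones and a tail of zeros; the latter never occurs, because every theory
  has infinitely many theorems, such as the axioms \<open>p \<longrightarrow> (\<bottom> \<longrightarrow> p)\<close>.\<close>

definition binary_value :: "(nat \<Rightarrow> bool) \<Rightarrow> real" where
  "binary_value a = (\<Sum>k. (1/2) ^ Suc k * of_bool (a k))"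

lemma summable_binary: "summable (\<lambda>k. (1/2 :: real) ^ Suc k * of_bool (a k))"
proof (rule summable_comparison_test)
  show "\<exists>N. \<forall>n\<ge>N. norm ((1/2 :: real) ^ Suc n * of_bool (a n)) \<le> (1/2) ^ n"
    by (auto simp: of_bool_def)
  show "summable ((^) (1/2 :: real))"
    by (rule summable_geometric) simp
qed

lemma binary_value_mono:
  assumes "\<And>k. a k \<Longrightarrow> b k"
  shows "binary_value a \<le> binary_value b"
  unfolding binary_value_def using assms
  by (intro suminf_le summable_binary) (auto simp: of_bool_def)

text \<open>At the first difference \<open>m\<close>, \<open>b\<close> gains
  \<open>(1/2) ^ Suc m\<close>, which is the most that all later digits of \<open>a\<close> can
  contribute together. Some later digit 1 of \<open>b\<close> makes the inequality strict.\<close>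

lemma binary_value_less:
  assumes inf: "\<exists>\<^sub>\<infinity>k. b k" and m: "\<not> a m" "b m" and eq: "\<And>k. k < m \<Longrightarrow> a k = b k"
  shows "binary_value a < binary_value b"
proof -
  define f where "f c k = (1/2 :: real) ^ Suc k * of_bool (c k)" for c k
  have sm: "summable (f c)" for c
    unfolding f_def by (rule summable_binary)
  have tail_sm: "summable (\<lambda>k. f c (k + Suc m))" for c
    using sm by (subst summable_iff_shift)
  have split: "binary_value c = (\<Sum>k. f c (k + Suc m)) + (\<Sum>k<m. f c k) + f c m" for c
    using suminf_split_initial_segment[OF sm, of c "Suc m"]
    unfolding binary_value_def f_def[symmetric] by simp
  have geo: "(\<lambda>k. (1/2 :: real) ^ Suc (k + Suc m)) sums (1/2) ^ Suc m"
    using sums_mult[OF power_half_series, of "(1/2) ^ Suc m"]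
    by (simp add: power_add mult.commute)
  have "(\<Sum>k. f a (k + Suc m)) \<le> (\<Sum>k. (1/2 :: real) ^ Suc (k + Suc m))"
    by (intro suminf_le tail_sm sums_summable[OF geo]) (simp add: f_def of_bool_def)
  also have "\<dots> = f b m"
    using geo m by (simp add: sums_iff f_def)
  finally have a_tail: "(\<Sum>k. f a (k + Suc m)) \<le> f b m" .
  obtain n where n: "n > m" "b n"
    using inf by (auto simp: INFM_nat)
  have "0 < (\<Sum>k. f b (k + Suc m))"
    \<comment> \<open>In the tail shifted by \<open>Suc m\<close>, digit \<open>n\<close> of
      \<open>b\<close> sits at position \<open>n - Suc m\<close>.\<close>
    using n by (intro suminf_pos2[OF tail_sm, of _ "n - Suc m"]) (auto simp: f_def)
  moreover have "(\<Sum>k<m. f a k) = (\<Sum>k<m. f b k)"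
    using eq by (intro sum.cong) (auto simp: f_def)
  moreover have "f a m = 0"
    using m by (simp add: f_def)
  ultimately show ?thesis
    using a_tail by (simp add: split)
qed

text \<open>At the least index of disagreement exactly one sequence has digit 1, and that one has
  the greater value. Since it may be either, both need infinitely many ones.\<close>

lemma binary_value_inject:
  assumes "\<exists>\<^sub>\<infinity>k. a k" "\<exists>\<^sub>\<infinity>k. b k" "binary_value a = binary_value b"
  shows "a = b"
proof (rule ccontr)
  assume "a \<noteq> b"
  then have ex: "\<exists>k. a k \<noteq> b k" by auto
  define m where "m = (LEAST k. a k \<noteq> b k)"
  have "a m \<noteq> b m"
    unfolding m_def by (rule LeastI_ex[OF ex])
  moreover have eq: "a k = b k" if "k < m" for k
    using not_less_Least that unfolding m_def by blast
  ultimately show False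
    using binary_value_less[of b a m] binary_value_less[of a b m] assms by auto
qed

lemma valuation_eq_binary_value:
  "valuation pr \<psi> T = binary_value (\<lambda>k. pr T (\<psi> (Suc k)))"
  by (simp add: valuation_def binary_value_def W_def proves_theory_def of_bool_def)

lemma lists_all_iff_range: "lists_all \<psi> S \<longleftrightarrow> range (\<lambda>k. \<psi> (Suc k)) = S"
  by (simp add: lists_all_def greaterThan_0 image_image)

text \<open>By cut, if \<open>T\<close> proves \<open>U\<close>, every digit 1 of \<open>U\<close>
  is a digit 1 of \<open>T\<close>, so the value of \<open>U\<close> cannot exceed that of
  \<open>T\<close>.\<close>

lemma HP_valuation:
  assumes cut: "\<And>T U p. proves_theory pr T U \<Longrightarrow> pr U p \<Longrightarrow> pr T p"
  shows "HP S pr (valuation pr \<psi>)"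
  unfolding HP_def valuation_eq_binary_value
  by (meson binary_value_mono cut not_le)

lemma EP_valuation:
  assumes hyp: "\<And>T p. p \<in> T \<Longrightarrow> pr T p"
    and lists: "lists_all \<psi> S" and inf: "\<And>T. infinite {p \<in> S. pr T p}"
  shows "EP S pr (valuation pr \<psi>)"
  unfolding EP_def
proof (intro allI impI)
  fix T U
  assume TU: "T \<subseteq> S" "U \<subseteq> S" and eq: "valuation pr \<psi> T = valuation pr \<psi> U"
  have range: "range (\<lambda>k. \<psi> (Suc k)) = S"
    using lists by (simp add: lists_all_iff_range)
  \<comment> \<open>Finitely many indices would list only finitely many theorems. This direction
    holds even if the list repeats sentences.\<close>
  have "\<exists>\<^sub>\<infinity>k. pr T' (\<psi> (Suc k))" for T'
  proof -
    have "{p \<in> S. pr T' p} = (\<lambda>k. \<psi> (Suc k)) ` {k. pr T' (\<psi> (Suc k))}"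
      using range by auto
    then show ?thesis
      using inf[of T'] by (metis finite_imageI frequently_cofinite)
  qed
  then have "(\<lambda>k. pr T (\<psi> (Suc k))) = (\<lambda>k. pr U (\<psi> (Suc k)))"
    using eq by (intro binary_value_inject) (simp_all add: valuation_eq_binary_value)
  then have "pr T p = pr U p" if "p \<in> S" for p
    using that range by (metis (mono_tags, lifting) imageE)
  \<comment> \<open>Each theory proves its own members, which lie in \<open>S\<close>; having the
    same theorems in \<open>S\<close>, the other theory proves them too.\<close>
  then show "equiv_theory pr T U"
    using TU hyp unfolding equiv_theory_def proves_theory_def by (meson subsetD)
qed

lemma pprovable_cut:
  assumes "proves_theory (pprovable A) T U" "pprovable A U p"
  shows "pprovable A T p"
  using assms(2,1)
  by induction (auto simp: proves_theory_def intro: pprovable.intros)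

text \<open>Each hypothesis in a derivation from \<open>U\<close> is replaced by its derivation from
  \<open>T\<close>. The other steps carry over, \<open>gen\<close> included, as its use is not
  restricted by the hypotheses.\<close>

lemma provable_cut:
  assumes "proves_theory (provable L) T U" "provable L U p"
  shows "provable L T p"
  using assms(2,1)
  by induction (auto simp: proves_theory_def intro: provable.intros)

text \<open>In a finite set, \<open>h\<close> would lead from an element of maximal size to a still
  larger one.\<close>

lemma infinite_if_closed:
  fixes h :: "'s \<Rightarrow> 's" and size :: "'s \<Rightarrow> nat"
  assumes "x \<in> S" "\<And>p. p \<in> S \<Longrightarrow> h p \<in> S" "\<And>p. size p < size (h p)"
  shows "infinite S"
proof
  assume fin: "finite S"
  obtain p where "p \<in> S" "\<And>q. q \<in> S \<Longrightarrow> size q \<le> size p"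
    using fin assms(1) finite_has_maximal[of "size ` S"]
    by (metis Max_ge Max_in empty_iff finite_imageI image_eqI image_iff)
  then show False
    using assms(2,3) by (metis not_le)
qed

text \<open>Starting from \<open>PBot\<close> yields infinitely many sentences even if
  \<open>A\<close> is empty. Distinct \<open>p\<close> give distinct axioms
  \<open>PImp p (PImp PBot p)\<close>, whatever \<open>T\<close> is.\<close>

lemma infinite_ptheorems: "infinite {p \<in> psentences A. pprovable A T p}"
proof -
  have "infinite (psentences A)"
    by (rule infinite_if_closed[of PBot _ "\<lambda>p. PAnd p PBot" size])
      (auto simp: psentences_def)
  then have "infinite ((\<lambda>p. PImp p (PImp PBot p)) ` psentences A)"
    by (subst finite_image_iff) (auto simp: inj_on_def)
  moreover have "(\<lambda>p. PImp p (PImp PBot p)) ` psentences A \<subseteq> {p \<in> psentences A. pprovable A T p}"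
    by (auto simp: psentences_def intro!: pprovable.ax paxiom.intros(1))
  ultimately show ?thesis
    using infinite_super by blast
qed

lemma infinite_theorems: "infinite {p \<in> sentences L. provable L T p}"
proof -
  have "infinite (sentences L)"
    \<comment> \<open>Conjunction with \<open>Bot\<close> adds neither symbols of \<open>L\<close>
      nor free variables, so it maps sentences to longer sentences.\<close>
    by (rule infinite_if_closed[of Bot _ "\<lambda>p. And p Bot" size])
      (auto simp: sentences_def)
  then have "infinite ((\<lambda>p. Imp p (Imp Bot p)) ` sentences L)"
    by (subst finite_image_iff) (auto simp: inj_on_def)
  moreover have "(\<lambda>p. Imp p (Imp Bot p)) ` sentences L \<subseteq> {p \<in> sentences L. provable L T p}"
    by (auto simp: sentences_def intro!: provable.ax axiom.intros(1))
  ultimately show ?thesis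
    using infinite_super by blast
qed

theorem theoremI3p8:
  fixes A :: "'a set" and \<phi> :: "nat \<Rightarrow> 'a pform"
    and L :: "('f, 'r) lang" and \<psi> :: "nat \<Rightarrow> ('f, 'r) fm"
  shows "(countable A \<longrightarrow> lists_all \<phi> (psentences A) \<longrightarrow>
            HP (psentences A) (pprovable A) (valuation (pprovable A) \<phi>) \<and>
            EP (psentences A) (pprovable A) (valuation (pprovable A) \<phi>)) \<and>
         (countable (funs L) \<longrightarrow> countable (rels L) \<longrightarrow> lists_all \<psi> (sentences L) \<longrightarrow>
            HP (sentences L) (provable L) (valuation (provable L) \<psi>) \<and>
            EP (sentences L) (provable L) (valuation (provable L) \<psi>))"
proof (intro conjI impI)
  show "HP (psentences A) (pprovable A) (valuation (pprovable A) \<phi>)"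
    by (rule HP_valuation) (rule pprovable_cut)
  show "HP (sentences L) (provable L) (valuation (provable L) \<psi>)"
    by (rule HP_valuation) (rule provable_cut)
  show "EP (psentences A) (pprovable A) (valuation (pprovable A) \<phi>)"
    if "lists_all \<phi> (psentences A)"
    by (rule EP_valuation[OF pprovable.hyp that infinite_ptheorems])
  show "EP (sentences L) (provable L) (valuation (provable L) \<psi>)"
    if "lists_all \<psi> (sentences L)"
    by (rule EP_valuation[OF provable.hyp that infinite_theorems])
qed

end
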